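(* Let $M\cong\mathbb{R}^4$ be equipped with the causal order of the Minkowski metric $\eta=\mathrm{diag}(-1,1,1,1)$, which determines the conformal class $[\eta]=\{\lambda^2\eta:\lambda>0\}$. Let $(\Gamma,\tau_{\mathrm{clock}})$ be a single clock following an inertial trajectory, i.e. $\Gamma\subset M$ is a timelike straight worldline and $\tau_{\mathrm{clock}}:\Gamma\to\mathbb{R}$ is its reading function, and suppose that this clock is ideal with respect to the physical metric $g_\star\in[\eta]$. Then $g_\star$ is uniquely determined by the causal order and the clock: if $g\in[\eta]$ is any metric with respect to which $(\Gamma,\tau_{\mathrm{clock}})$ is ideal, then $g=g_\star$.
   Context: Signature convention: $(-,+,+,+)$, so a vector $v$ is timelike for a metric $g\in[\eta]$ if $g(v,v)<0$ and null if $v\neq 0$ and $g(v,v)=0$; a timelike or null vector is future-directed if its time component $v^0$ is positive. Causal order: for $x,y\in M$, $x\prec y$ means that a future-directed timelike or null signal can travel from $x$ to $y$, i.e. $y-x$ is a future-directed timelike or null vector for $\eta$. Conformal class: the conformal class determined by the causal structure is $[\eta]=\{\lambda^2\eta:\lambda>0\}$, where $\lambda$ is a constant. Proper time: for a smooth timelike curve $\gamma:I\to M$ with arbitrary parameter $s\in I\subseteq\mathbb{R}$ ($I$ an interval with nonempty interior) and a metric $g\in[\eta]$, the proper time along $\gamma$ with respect to $g$ is $$\tau_g(s)=\int_{s_0}^{s}\sqrt{-g(\dot\gamma(s'),\dot\gamma(s'))}\,ds',$$ where $s_0\in I$ is a reference parameter value and the dot denotes $d/ds'$. Clock: a (bona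 fide) clock is a pair $(\Gamma,\tau_{\mathrm{clock}})$ consisting of a timelike worldline $\Gamma\subset M$, considered as a point set, and a reading function $\tau_{\mathrm{clock}}:\Gamma\to\mathbb{R}$ along it. Both are given independently of any choice of coordinates or metric. Ideal clock: the clock is ideal with respect to a metric $g$ if its readings coincide with proper time, i.e. for every smooth future-directed timelike parameterization $\gamma:I\to\Gamma$ of the worldline there is a real constant such that $\tau_{\mathrm{clock}}(\gamma(s))=\tau_g(s)+\mathrm{const}$ for all $s\in I$. Inertial trajectory: the worldline is a timelike straight line, $\Gamma=\{p+su: s\in I\}$ with $p\in M$, $u$ a timelike vector, and $I\subseteq\mathbb{R}$ an interval with nonempty interior. *)

theory Defs
  imports "HOL-Analysis.Analysis"
begin

text \<open>Spacetime points and vectors are elements of \<open>real ^ 4\<close>. The index type \<open>4\<close> is the integers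
  modulo 4, so its four elements are \<open>0, 1, 2, 3\<close>; the time component of \<open>v\<close> is \<open>v $ 0\<close>.\<close>

type_synonym spacetime = "real ^ 4"

type_synonym metric = "spacetime \<Rightarrow> spacetime \<Rightarrow> real"

definition minkowski :: metric where
  "minkowski v w = - (v $ 0 * w $ 0) + v $ 1 * w $ 1 + v $ 2 * w $ 2 + v $ 3 * w $ 3"

definition conformal_class :: "metric \<Rightarrow> metric set" where
  "conformal_class h = {(\<lambda>v w. l\<^sup>2 * h v w) | l :: real. l > 0}"

definition timelike :: "metric \<Rightarrow> spacetime \<Rightarrow> bool" where
  "timelike g v \<longleftrightarrow> g v v < 0"

definition null :: "metric \<Rightarrow> spacetime \<Rightarrow> bool" where
  "null g v \<longleftrightarrow> v \<noteq> 0 \<and> g v v = 0"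

definition future_directed :: "spacetime \<Rightarrow> bool" where
  "future_directed v \<longleftrightarrow> v $ 0 > 0"

definition causally_precedes :: "metric \<Rightarrow> spacetime \<Rightarrow> spacetime \<Rightarrow> bool" where
  "causally_precedes g x y \<longleftrightarrow> (timelike g (y - x) \<or> null g (y - x)) \<and> future_directed (y - x)"

text \<open>All metrics in the conformal class of the Minkowski metric induce the same causal order.\<close>

lemma causally_precedes_conformal:
  assumes "g \<in> conformal_class minkowski"
  shows "causally_precedes g = causally_precedes minkowski"
proof -
  obtain l :: real where l: "l > 0" "g = (\<lambda>v w. l\<^sup>2 * minkowski v w)"
    using assms by (auto simp: conformal_class_def)
  have "timelike g = timelike minkowski" "null g = null minkowski"
    using l by (auto simp: fun_eq_iff timelike_def null_def mult_less_0_iff)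
  then show ?thesis
    by (simp add: fun_eq_iff causally_precedes_def)
qed

definition proper_interval :: "real set \<Rightarrow> bool" where
  "proper_interval I \<longleftrightarrow> is_interval I \<and> interior I \<noteq> {}"

text \<open>Derivatives are taken within \<open>I\<close>, hence one-sided at end points belonging to \<open>I\<close>; \<open>D n\<close> is
  the \<open>n\<close>-th derivative.\<close>

definition smooth_curve_on :: "real set \<Rightarrow> (real \<Rightarrow> spacetime) \<Rightarrow> bool" where
  "smooth_curve_on I \<gamma> \<longleftrightarrow>
     (\<exists>D :: nat \<Rightarrow> real \<Rightarrow> spacetime. D 0 = \<gamma> \<and>
        (\<forall>n. \<forall>s\<in>I. (D n has_vector_derivative D (Suc n) s) (at s within I)))"

definition velocity :: "real set \<Rightarrow> (real \<Rightarrow> spacetime) \<Rightarrow> real \<Rightarrow> spacetime" where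
  "velocity I \<gamma> s = vector_derivative \<gamma> (at s within I)"

text \<open>The interval integral is oriented, so proper time is negative for \<open>s < s\<^sub>0\<close>.\<close>

definition proper_time :: "metric \<Rightarrow> real set \<Rightarrow> (real \<Rightarrow> spacetime) \<Rightarrow> real \<Rightarrow> real \<Rightarrow> real" where
  "proper_time g I \<gamma> s\<^sub>0 s =
     (LBINT s'=ereal s\<^sub>0..ereal s. sqrt (- g (velocity I \<gamma> s') (velocity I \<gamma> s')))"

text \<open>A parameterization traverses the whole point set \<open>\<Gamma>\<close>.\<close>

definition future_timelike_parameterization ::
    "metric \<Rightarrow> spacetime set \<Rightarrow> real set \<Rightarrow> (real \<Rightarrow> spacetime) \<Rightarrow> bool" where
  "future_timelike_parameterization g \<Gamma> I \<gamma> \<longleftrightarrow>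
     proper_interval I \<and> smooth_curve_on I \<gamma> \<and> \<gamma> ` I = \<Gamma> \<and>
     (\<forall>s\<in>I. timelike g (velocity I \<gamma> s) \<and> future_directed (velocity I \<gamma> s))"

text \<open>A clock is a worldline \<open>\<Gamma>\<close> with a reading function, of which only the values on \<open>\<Gamma>\<close> matter.
  The choice of the reference parameter \<open>s\<^sub>0\<close> affects only the additive constant.\<close>

definition ideal_clock :: "metric \<Rightarrow> spacetime set \<Rightarrow> (spacetime \<Rightarrow> real) \<Rightarrow> bool" where
  "ideal_clock g \<Gamma> \<tau> \<longleftrightarrow>
     (\<forall>I \<gamma>. future_timelike_parameterization g \<Gamma> I \<gamma> \<longrightarrow>
        (\<forall>s\<^sub>0\<in>I. \<exists>c. \<forall>s\<in>I. \<tau> (\<gamma> s) = proper_time g I \<gamma> s\<^sub>0 s + c))"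

definition inertial_trajectory :: "spacetime set \<Rightarrow> bool" where
  "inertial_trajectory \<Gamma> \<longleftrightarrow>
     (\<exists>p u I. timelike minkowski u \<and> proper_interval I \<and> \<Gamma> = (\<lambda>s. p + s *\<^sub>R u) ` I)"

end

theory Submission
  imports Defs
begin

text \<open>Rescaling the metric by \<open>\<lambda>\<^sup>2\<close> multiplies every proper time by \<open>\<lambda>\<close>. On a straight worldline the
  affine parameterization has constant velocity, so along it an ideal clock for \<open>\<lambda>\<^sup>2\<eta>\<close> advances by
  \<open>\<lambda>\<close> times the nonzero Minkowskian length between two distinct events. A single such reading
  therefore fixes \<open>\<lambda>\<close>.\<close>

lemma proper_interval_imp_less:
  assumes "proper_interval I"
  obtains a b where "a \<in> I" "b \<in> I" "a < b"
proof -
  obtain x where "x \<in> interior I"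
    using assms by (auto simp: proper_interval_def)
  then obtain e where e: "e > 0" "ball x e \<subseteq> I"
    by (auto simp: mem_interior)
  have "x \<in> ball x e" "x + e / 2 \<in> ball x e"
    using e(1) by (auto simp: dist_real_def)
  then show thesis
    using that[of x "x + e / 2"] e by (meson half_gt_zero less_add_same_cancel1 subsetD)
qed

lemma proper_interval_uminus:
  assumes "proper_interval I"
  shows "proper_interval (uminus ` I)"
  using assms by (simp add: proper_interval_def interior_negations)

text \<open>A connected set with two distinct points has no isolated point. This makes derivatives
  within \<open>I\<close> unique, also at end points that belong to \<open>I\<close>.\<close>

lemma proper_interval_at_within_neq_bot:
  assumes "proper_interval I" "s \<in> I"
  shows "at s within I \<noteq> bot"
proof -
  obtain a b where "a \<in> I" "b \<in> I" "a < b"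
    using proper_interval_imp_less[OF assms(1)] .
  then have "\<And>x. I \<noteq> {x}"
    by auto
  moreover have "connected I"
    using assms(1) by (simp add: proper_interval_def is_interval_connected)
  ultimately show ?thesis
    using assms(2) connected_imp_perfect trivial_limit_within by blast
qed

text \<open>Without a time component the Minkowski form is a sum of squares, hence
  nonnegative.\<close>

lemma timelike_imp_time_component_neq_0:
  assumes "timelike minkowski u"
  shows "u $ 0 \<noteq> 0"
proof
  assume "u $ 0 = 0"
  then have "minkowski u u = (u $ 1)\<^sup>2 + (u $ 2)\<^sup>2 + (u $ 3)\<^sup>2"
    by (simp add: minkowski_def power2_eq_square)
  also have "\<dots> \<ge> 0"
    by simp
  finally show False
    using assms by (simp add: timelike_def)
qed

lemma timelike_minkowski_uminus [simp]:
  "timelike minkowski (- u) \<longleftrightarrow> timelike minkowski u"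
  by (simp add: timelike_def minkowski_def)

text \<open>An ideal clock is constrained only along future-directed parameterizations, whereas
  \<open>inertial_trajectory\<close> leaves the time orientation of \<open>u\<close> open. If
  \<open>u\<close> points to the past, reversing the parameter describes the same point set with
  direction \<open>- u\<close>.\<close>

lemma inertial_trajectory_future_directed:
  assumes "inertial_trajectory \<Gamma>"
  obtains p u I where "timelike minkowski u" "future_directed u" "proper_interval I"
    "\<Gamma> = (\<lambda>s. p + s *\<^sub>R u) ` I"
proof -
  obtain p u I where u: "timelike minkowski u" and I: "proper_interval I"
    and \<Gamma>: "\<Gamma> = (\<lambda>s. p + s *\<^sub>R u) ` I"
    using assms by (auto simp: inertial_trajectory_def)
  show thesis
  proof (cases "u $ 0 > 0")
    case True
    then show thesis
      using that u I \<Gamma> by (simp add: future_directed_def)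
  next
    case False
    then have "future_directed (- u)"
      using timelike_imp_time_component_neq_0[OF u] by (simp add: future_directed_def)
    moreover have "\<Gamma> = (\<lambda>s. p + s *\<^sub>R (- u)) ` uminus ` I"
      by (simp add: \<Gamma> image_image)
    ultimately show thesis
      using that[of "- u" "uminus ` I" p] u proper_interval_uminus[OF I] by simp
  qed
qed

lemma line_has_vector_derivative:
  "((\<lambda>s. p + s *\<^sub>R u) has_vector_derivative u) (at s within I)"
  unfolding has_vector_derivative_def by (auto intro!: derivative_eq_intros)

lemma velocity_line:
  assumes "proper_interval I" "s \<in> I"
  shows "velocity I (\<lambda>s. p + s *\<^sub>R u) s = u"
  unfolding velocity_def
  by (rule vector_derivative_within)
    (simp_all add: proper_interval_at_within_neq_bot assms line_has_vector_derivative)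

lemma smooth_curve_on_line: "smooth_curve_on I (\<lambda>s. p + s *\<^sub>R u)"
proof -
  \<comment> \<open>The derivatives of an affine curve: the curve itself, its constant velocity,
    then zero.\<close>
  define D :: "nat \<Rightarrow> real \<Rightarrow> spacetime"
    where "D n = (case n of 0 \<Rightarrow> (\<lambda>s. p + s *\<^sub>R u) | Suc 0 \<Rightarrow> (\<lambda>_. u) | _ \<Rightarrow> (\<lambda>_. 0))" for n
  have "(D n has_vector_derivative D (Suc n) s) (at s within I)" for n s
    by (auto simp: D_def line_has_vector_derivative split: nat.split)
  moreover have "D 0 = (\<lambda>s. p + s *\<^sub>R u)"
    by (simp add: D_def)
  ultimately show ?thesis
    unfolding smooth_curve_on_def by blast
qed

lemma future_timelike_parameterization_line:
  assumes "timelike g u" "future_directed u" "proper_interval I"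
  shows "future_timelike_parameterization g ((\<lambda>s. p + s *\<^sub>R u) ` I) I (\<lambda>s. p + s *\<^sub>R u)"
  using assms
  by (simp add: future_timelike_parameterization_def smooth_curve_on_line velocity_line)

lemma proper_time_line:
  assumes "proper_interval I" "a \<in> I" "b \<in> I" "a \<le> b"
  shows "proper_time g I (\<lambda>s. p + s *\<^sub>R u) a b = sqrt (- g u u) * (b - a)"
proof -
  \<comment> \<open>The integrands need to agree only on the open interval between \<open>a\<close>
    and \<open>b\<close>, which lies in \<open>I\<close> by convexity.\<close>
  have "s \<in> I" if "a < s" "s < b" for s
    using assms that unfolding proper_interval_def is_interval_1 by (meson less_imp_le)
  then have "proper_time g I (\<lambda>s. p + s *\<^sub>R u) a b =
      (LBINT s=ereal a..ereal b. sqrt (- g u u))"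
    unfolding proper_time_def
    using assms by (intro interval_integral_cong) (auto simp: einterval_iff velocity_line)
  then show ?thesis
    using assms(4) by simp
qed

text \<open>With \<open>a\<close> as the reference parameter, proper time vanishes at
  \<open>a\<close>, and the additive constant cancels in the difference of readings.\<close>

lemma ideal_clock_line_reading:
  assumes "ideal_clock g ((\<lambda>s. p + s *\<^sub>R u) ` I) \<tau>"
    and "timelike g u" "future_directed u" "proper_interval I"
    and "a \<in> I" "b \<in> I" "a \<le> b"
  shows "\<tau> (p + b *\<^sub>R u) - \<tau> (p + a *\<^sub>R u) = sqrt (- g u u) * (b - a)"
proof -
  obtain c where c: "\<And>s. s \<in> I \<Longrightarrow>
      \<tau> (p + s *\<^sub>R u) = proper_time g I (\<lambda>s. p + s *\<^sub>R u) a s + c"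
    using assms(1) future_timelike_parameterization_line[OF assms(2-4)] \<open>a \<in> I\<close>
    unfolding ideal_clock_def by blast
  show ?thesis
    using assms(4-7) by (simp add: c proper_time_line)
qed

theorem theorem3:
  fixes \<Gamma> :: "spacetime set" and \<tau>_clock :: "spacetime \<Rightarrow> real" and g g_star :: metric
  assumes "inertial_trajectory \<Gamma>"
    and "g_star \<in> conformal_class minkowski"
    and "ideal_clock g_star \<Gamma> \<tau>_clock"
    and "g \<in> conformal_class minkowski"
    and "ideal_clock g \<Gamma> \<tau>_clock"
  shows "g = g_star"
proof -
  obtain p u I where u: "timelike minkowski u" "future_directed u" and I: "proper_interval I"
    and \<Gamma>: "\<Gamma> = (\<lambda>s. p + s *\<^sub>R u) ` I"
    using inertial_trajectory_future_directed[OF assms(1)] .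
  obtain a b where ab: "a \<in> I" "b \<in> I" "a < b"
    using proper_interval_imp_less[OF I] .
  obtain k where k: "k > 0" "g_star = (\<lambda>v w. k\<^sup>2 * minkowski v w)"
    using assms(2) by (auto simp: conformal_class_def)
  obtain l where l: "l > 0" "g = (\<lambda>v w. l\<^sup>2 * minkowski v w)"
    using assms(4) by (auto simp: conformal_class_def)
  have "timelike g u" "timelike g_star u"
    using u(1) k l by (auto simp: timelike_def mult_less_0_iff)
  \<comment> \<open>Both sides equal the same difference of clock readings between the events at
    \<open>a\<close> and \<open>b\<close>.\<close>
  then have "sqrt (- g u u) * (b - a) = sqrt (- g_star u u) * (b - a)"
    using ideal_clock_line_reading[OF assms(5)[unfolded \<Gamma>] _ u(2) I ab(1,2)]
      ideal_clock_line_reading[OF assms(3)[unfolded \<Gamma>] _ u(2) I ab(1,2)] ab(3)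
    by simp
  then have "g u u = g_star u u"
    using ab(3) by simp
  \<comment> \<open>The common factor \<open>minkowski u u\<close> is nonzero because
    \<open>u\<close> is timelike. Equality of the squares suffices, since the metrics depend only on
    them.\<close>
  then have "l\<^sup>2 = k\<^sup>2"
    using u(1) by (simp add: k(2) l(2) timelike_def)
  then show ?thesis
    by (simp add: k(2) l(2))
qed

end
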